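(* Let $K_{n,n}$ be the complete bipartite graph with both parts of size $n$. Then $\chi_g^\infty(K_{n,n}) \leq 5$ when $n \geq 5$.
   Context: The eternal vertex coloring game (A-game) on a finite undirected graph $G$ with color set $\{1,\ldots,k\}$: all vertices are initially uncolored. Alice and Bob strictly alternate turns, Alice moving first overall. On a turn the player chooses one vertex. If it is uncolored, the player must give it a color not currently used on any of its neighbors; if it currently has color $c$, the player must change its color to a color different from $c$ that is not currently used on any of its neighbors. The player whose turn it is picks the vertex and the new color. Play proceeds in rounds: every vertex must be chosen $t$ times before any vertex is chosen $t+1$ times, for every integer $t\ge 1$ (so each vertex is chosen exactly once per round; turns keep alternating across rounds, so if $|V(G)|$ is odd Bob moves first in even-numbered rounds). If some player chooses a vertex $v$ (still available in the current round) that cannot be legally colored, i.e. every color in the color set other than the current color of $v$ (if any) appears on a neighbor of $v$, then Bob wins. In particular Bob may deliberately choose such a vertex. Alice wins if this never happens (the game goes on forever). The eternal game chromatic number $\chi_g^\infty(G)$ is the minimum $k$ such that Alice has a winning strategy on $G$ with $k$ colors. *)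

theory Defs
  imports "Graph_Theory.Kuratowski" "HOL-Library.Extended_Nat"
begin

text \<open>
  A finite undirected graph is a symmetric digraph satisfying the locale \<open>graph\<close>; the neighbours of
  \<open>v\<close> are the \<open>u\<close> with \<open>v \<rightarrow>\<^bsub>G\<^esub> u\<close>. A position is the list of all moves made so far,
  oldest first; a move \<open>(v, c)\<close> chooses the vertex \<open>v\<close> and gives it the colour \<open>c\<close>.
\<close>

type_synonym 'a move = "'a \<times> nat"

definition times_chosen :: "'a move list \<Rightarrow> 'a \<Rightarrow> nat" where
  "times_chosen h v = count_list (map fst h) v"

text \<open>\<open>map_of\<close> returns the first matching entry, hence the reversal; \<open>None\<close> means uncoloured.\<close>

definition current_colour :: "'a move list \<Rightarrow> 'a \<Rightarrow> nat option" where
  "current_colour h = map_of (rev h)"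

text \<open>Every vertex is chosen \<open>t\<close> times before any vertex is chosen \<open>t + 1\<close> times.\<close>

definition available :: "('a, 'b) pre_digraph \<Rightarrow> 'a move list \<Rightarrow> 'a \<Rightarrow> bool" where
  "available G h v \<longleftrightarrow>
     v \<in> verts G \<and> (\<forall>u\<in>verts G. times_chosen h v \<le> times_chosen h u)"

definition legal_colour :: "('a, 'b) pre_digraph \<Rightarrow> nat \<Rightarrow> 'a move list \<Rightarrow> 'a \<Rightarrow> nat \<Rightarrow> bool" where
  "legal_colour G k h v c \<longleftrightarrow>
     c \<in> {1..k} \<and> current_colour h v \<noteq> Some c \<and>
     (\<forall>u. v \<rightarrow>\<^bsub>G\<^esub> u \<longrightarrow> current_colour h u \<noteq> Some c)"

definition legal_move :: "('a, 'b) pre_digraph \<Rightarrow> nat \<Rightarrow> 'a move list \<Rightarrow> 'a move \<Rightarrow> bool" where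
  "legal_move G k h m \<longleftrightarrow> available G h (fst m) \<and> legal_colour G k h (fst m) (snd m)"

definition alices_turn :: "'a move list \<Rightarrow> bool" where
  "alices_turn h \<longleftrightarrow> even (length h)"

text \<open>The positions that can arise when Alice follows the strategy \<open>\<sigma>\<close> and Bob plays arbitrarily.\<close>

inductive consistent ::
  "('a, 'b) pre_digraph \<Rightarrow> nat \<Rightarrow> ('a move list \<Rightarrow> 'a move) \<Rightarrow> 'a move list \<Rightarrow> bool"
  for G k \<sigma> where
  start: "consistent G k \<sigma> []"
| alice: "consistent G k \<sigma> h \<Longrightarrow> alices_turn h \<Longrightarrow> legal_move G k h (\<sigma> h)
          \<Longrightarrow> consistent G k \<sigma> (h @ [\<sigma> h])"
| bob: "consistent G k \<sigma> h \<Longrightarrow> \<not> alices_turn h \<Longrightarrow> legal_move G k h m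
        \<Longrightarrow> consistent G k \<sigma> (h @ [m])"

text \<open>
  Alice must always answer with a legal move, so in particular she never chooses a vertex that
  cannot be coloured. Bob wins at once if he can choose an available vertex that cannot be coloured,
  so at Bob's turns no such vertex may exist. On a graph with at least one vertex these
  two conditions together say that every play following \<open>\<sigma>\<close> goes on forever.
\<close>

definition winning_strategy ::
  "('a, 'b) pre_digraph \<Rightarrow> nat \<Rightarrow> ('a move list \<Rightarrow> 'a move) \<Rightarrow> bool" where
  "winning_strategy G k \<sigma> \<longleftrightarrow>
     (\<forall>h. consistent G k \<sigma> h \<longrightarrow>
        (if alices_turn h then legal_move G k h (\<sigma> h)
         else (\<forall>v. available G h v \<longrightarrow> (\<exists>c. legal_colour G k h v c))))"

text \<open>
  The value is an extended natural number, so that the minimum over an empty set would be \<open>\<infinity>\<close>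
  rather than unspecified.
\<close>

definition eternal_game_chromatic_number :: "('a, 'b) pre_digraph \<Rightarrow> enat" where
  "eternal_game_chromatic_number G = (INF k \<in> {k. \<exists>\<sigma>. winning_strategy G k \<sigma>}. enat k)"

end

theory Submission
  imports Defs
begin

text \<open>
  If both sides carry at least two colours, then both carry at most three of the five colours, so every
  vertex can be recoloured. Alice keeps this invariant. As soon as the vertices of a side already
  chosen in the current round show two colours, that side is secured for the rest of the round.
  A side in danger is one that Bob has just touched, and Alice secures it at once. Otherwise she uses
  her moves to secure the sides: she first prepares a side by creating a played vertex and an
  unplayed vertex of the same colour, so that recolouring the latter, by whichever player, secures
  the side. In the first round she always adds a new colour on the side with fewer colours; within
  seven moves both sides carry two colours, and five vertices on a side suffice for this.
\<close>

section \<open>From invariants to a strategy\<close>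

text \<open>\<open>M\<close> is the invariant at Alice's turns, \<open>J\<close> the one at Bob's. A
  suitable reply exists wherever \<open>M\<close> holds, so the strategy can be obtained by
  choice.\<close>

lemma winning_strategyI:
  assumes start: "M []"
    and alice: "\<And>h. \<lbrakk>alices_turn h; M h\<rbrakk> \<Longrightarrow> \<exists>m. legal_move G k h m \<and> J (h @ [m])"
    and safe: "\<And>h v. \<lbrakk>\<not> alices_turn h; J h; available G h v\<rbrakk> \<Longrightarrow> \<exists>c. legal_colour G k h v c"
    and bob: "\<And>h m. \<lbrakk>\<not> alices_turn h; J h; legal_move G k h m\<rbrakk> \<Longrightarrow> M (h @ [m])"
  shows "\<exists>\<sigma>. winning_strategy G k \<sigma>"
proof -
  define \<sigma> where "\<sigma> h = (SOME m. legal_move G k h m \<and> J (h @ [m]))" for h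
  have \<sigma>: "legal_move G k h (\<sigma> h) \<and> J (h @ [\<sigma> h])" if "alices_turn h" "M h" for h
    unfolding \<sigma>_def using someI_ex[OF alice[OF that]] .
  have "if alices_turn h then M h else J h" if "consistent G k \<sigma> h" for h
    using that
  proof induction
    case start
    then show ?case using assms(1) by (simp add: alices_turn_def)
  next
    case (alice h)
    then show ?case using \<sigma> by (auto simp: alices_turn_def)
  next
    case (bob h m)
    then show ?case using assms(4) by (auto simp: alices_turn_def)
  qed
  then have "winning_strategy G k \<sigma>"
    unfolding winning_strategy_def using \<sigma> safe by (metis (full_types))
  then show ?thesis by blast
qed

section \<open>Effect of a move on colours, counts and rounds\<close>

lemma current_colour_snoc: "current_colour (h @ [(v, c)]) = (current_colour h)(v \<mapsto> c)"
  by (simp add: current_colour_def)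

lemma times_chosen_snoc:
  "times_chosen (h @ [(v, c)]) u = times_chosen h u + (if u = v then 1 else 0)"
  by (simp add: times_chosen_def)

definition balanced :: "('a, 'b) pre_digraph \<Rightarrow> 'a move list \<Rightarrow> bool" where
  "balanced G h \<longleftrightarrow> (\<forall>u\<in>verts G. \<forall>w\<in>verts G. times_chosen h u \<le> Suc (times_chosen h w))"

lemma balanced_snoc:
  assumes "balanced G h" "available G h v"
  shows "balanced G (h @ [(v, c)])"
  using assms by (auto simp: balanced_def available_def times_chosen_snoc le_Suc_eq)

text \<open>By balance the counts take at most two consecutive values, and the available vertices
  are those with the least count. Choosing the last of them makes all counts equal, which opens a
  new round.\<close>

lemma available_snoc:
  assumes "balanced G h" "available G h v"
  shows "Collect (available G (h @ [(v, c)])) =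
    (if Collect (available G h) - {v} = {} then verts G else Collect (available G h) - {v})"
proof (cases "Collect (available G h) - {v} = {}")
  case True
  have v: "v \<in> verts G" "\<And>u. u \<in> verts G \<Longrightarrow> times_chosen h v \<le> times_chosen h u"
    using assms(2) by (auto simp: available_def)
  have "times_chosen h u = Suc (times_chosen h v)" if u: "u \<in> verts G" "u \<noteq> v" for u
  proof -
    have "\<not> available G h u" using True u by auto
    then obtain w where "w \<in> verts G" "times_chosen h w < times_chosen h u"
      using u by (auto simp: available_def not_le)
    moreover have "times_chosen h u \<le> Suc (times_chosen h v)"
      using assms(1) v u by (auto simp: balanced_def)
    ultimately show ?thesis using v(2)[of w] by linarith
  qed
  then have "times_chosen (h @ [(v, c)]) u = Suc (times_chosen h v)" if "u \<in> verts G" for u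
    using that by (simp add: times_chosen_snoc)
  then show ?thesis using True by (auto simp: available_def)
next
  case False
  then obtain w where w: "available G h w" "w \<noteq> v" by auto
  have "available G (h @ [(v, c)]) u \<longleftrightarrow> available G h u \<and> u \<noteq> v" for u
  proof
    assume u: "available G (h @ [(v, c)]) u"
    then have "times_chosen (h @ [(v, c)]) u \<le> times_chosen (h @ [(v, c)]) w"
      using w by (auto simp: available_def)
    moreover have "times_chosen h w \<le> times_chosen h x" if "x \<in> verts G" for x
      using w that by (auto simp: available_def)
    moreover have "times_chosen h v = times_chosen h w"
      using w assms(2) by (auto simp: available_def intro: antisym)
    ultimately show "available G h u \<and> u \<noteq> v"
      using u w by (fastforce simp: available_def times_chosen_snoc split: if_splits)
  next
    assume "available G h u \<and> u \<noteq> v"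
    then show "available G (h @ [(v, c)]) u"
      by (auto simp: available_def times_chosen_snoc intro: le_SucI)
  qed
  then show ?thesis using False by auto
qed

section \<open>Colours shown on a set of vertices\<close>

definition colours :: "('a \<Rightarrow> nat option) \<Rightarrow> 'a set \<Rightarrow> nat set" where
  "colours f X = {c. Some c \<in> f ` X}"

lemma Some_image_colours: "Some ` colours f X \<subseteq> f ` X"
  by (auto simp: colours_def)

lemma finite_colours: "finite X \<Longrightarrow> finite (colours f X)"
  by (meson Some_image_colours finite_imageD finite_imageI finite_subset inj_Some)

lemma card_colours_le: "finite X \<Longrightarrow> card (colours f X) \<le> card X"
  by (metis Some_image_colours card_image card_image_le card_mono finite_imageI inj_Some order_trans)

lemma colours_mono: "X \<subseteq> Y \<Longrightarrow> colours f X \<subseteq> colours f Y"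
  by (auto simp: colours_def)

lemma colours_upd_outside: "v \<notin> X \<Longrightarrow> colours (f(v \<mapsto> c)) X = colours f X"
  by (force simp: colours_def)

lemma colours_upd: "v \<in> X \<Longrightarrow> colours (f(v \<mapsto> c)) X = insert c (colours f (X - {v}))"
  by (force simp: colours_def)

section \<open>Status of a side within a round\<close>

text \<open>In a state, \<open>f\<close> is the colouring and \<open>S\<close> the set of vertices still to be chosen in this round.\<close>

definition usable :: "('a \<Rightarrow> nat option) \<Rightarrow> 'a set \<Rightarrow> 'a \<Rightarrow> nat \<Rightarrow> bool" where
  "usable f Y v c \<longleftrightarrow> c \<in> {1..5} \<and> f v \<noteq> Some c \<and> c \<notin> colours f Y"

definition secured :: "('a \<Rightarrow> nat option) \<Rightarrow> 'a set \<Rightarrow> 'a set \<Rightarrow> bool" where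
  "secured f S X \<longleftrightarrow> 2 \<le> card (colours f (X - S))"

definition prepared :: "('a \<Rightarrow> nat option) \<Rightarrow> 'a set \<Rightarrow> 'a set \<Rightarrow> bool" where
  "prepared f S X \<longleftrightarrow> (\<exists>v\<in>X \<inter> S. f v \<in> f ` (X - S))"

text \<open>Uncoloured vertices are tolerated only on a secured side. A fully coloured side may also
  be untouched, since Alice can answer Bob's first choice there, or prepared.\<close>

definition good :: "('a \<Rightarrow> nat option) \<Rightarrow> 'a set \<Rightarrow> 'a set \<Rightarrow> bool" where
  "good f S X \<longleftrightarrow> secured f S X \<or> None \<notin> f ` X \<and> (X \<subseteq> S \<or> prepared f S X)"

text \<open>The second conjunct leaves at most three of the five colours to the other side, and it
  is the part that carries over to the next round.\<close>

definition safe :: "('a \<Rightarrow> nat option) \<Rightarrow> 'a set \<Rightarrow> 'a set \<Rightarrow> bool" where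
  "safe f S X \<longleftrightarrow> good f S X \<and> 2 \<le> card (colours f X)"

definition securable :: "('a \<Rightarrow> nat option) \<Rightarrow> 'a set \<Rightarrow> 'a set \<Rightarrow> 'a set \<Rightarrow> bool" where
  "securable f S X Y \<longleftrightarrow>
     (\<exists>v\<in>X \<inter> S. \<exists>c. usable f Y v c \<and> 2 \<le> card (insert c (colours f (X - S))))"

lemma safe_upd_outside:
  assumes "safe f S Y" "v \<notin> Y"
  shows "safe (f(v \<mapsto> c)) (S - {v}) Y"
proof -
  have "Y - (S - {v}) = Y - S" "Y \<inter> (S - {v}) = Y \<inter> S" "(f(v \<mapsto> c)) ` Y = f ` Y"
    "(f(v \<mapsto> c)) ` (Y - S) = f ` (Y - S)" "Y \<subseteq> S - {v} \<longleftrightarrow> Y \<subseteq> S"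
    using assms(2) by auto
  moreover have "colours (f(v \<mapsto> c)) (Y - S) = colours f (Y - S)"
    using assms(2) by (simp add: colours_upd_outside)
  moreover have "(\<exists>u\<in>Y \<inter> S. (f(v \<mapsto> c)) u \<in> f ` (Y - S)) \<longleftrightarrow> (\<exists>u\<in>Y \<inter> S. f u \<in> f ` (Y - S))"
    using assms(2) by (intro bex_cong) auto
  ultimately show ?thesis
    using assms by (simp add: safe_def good_def secured_def prepared_def colours_upd_outside)
qed

lemma played_colours_upd:
  assumes "v \<in> X \<inter> S"
  shows "colours (f(v \<mapsto> c)) (X - (S - {v})) = insert c (colours f (X - S))"
proof -
  have "X - (S - {v}) - {v} = X - S" "v \<in> X - (S - {v})" using assms by auto
  then show ?thesis by (metis colours_upd)
qed

lemma secured_imp_safe: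
  assumes "finite X" "secured f S X"
  shows "safe f S X"
  using assms card_mono[OF finite_colours[OF assms(1)] colours_mono[of "X - S" X f]]
  by (auto simp: safe_def good_def secured_def)

lemma securable_move:
  assumes "finite X" "v \<in> X \<inter> S" "2 \<le> card (insert c (colours f (X - S)))"
  shows "safe (f(v \<mapsto> c)) (S - {v}) X"
  using assms by (intro secured_imp_safe) (auto simp: secured_def played_colours_upd)

text \<open>Played vertices keep their colours until the round ends, so
  \<open>colours f (X - S)\<close> can only grow.\<close>

lemma secured_move:
  assumes "finite X" "v \<in> X \<inter> S" "secured f S X"
  shows "safe (f(v \<mapsto> c)) (S - {v}) X"
proof (rule securable_move[OF assms(1,2)])
  show "2 \<le> card (insert c (colours f (X - S)))"
    using assms card_insert_le[of "colours f (X - S)" c] finite_colours[of "X - S" f]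
    by (simp add: secured_def)
qed

section \<open>Invariants of the two players\<close>

text \<open>
  The played colours of the opening round are all the colours, since only uncoloured vertices are
  available. Each move of Alice adds a colour, hence the last conjunct, which ensures that neither side
  is used up before both carry two colours.
\<close>

definition opening_bob ::
  "('a \<Rightarrow> nat option) \<Rightarrow> 'a set \<Rightarrow> 'a set \<Rightarrow> 'a set \<Rightarrow> bool" where
  "opening_bob f S X Y \<longleftrightarrow> S = {v \<in> X \<union> Y. f v = None} \<and>
     card (colours f X) + card (colours f Y) \<le> 3 \<and>
     card (colours f X) \<le> Suc (card (colours f Y)) \<and>
     card (colours f Y) \<le> Suc (card (colours f X)) \<and>
     card (X \<union> Y - S) < 2 * (card (colours f X) + card (colours f Y))"

text \<open>Each bound is the one from \<open>opening_bob\<close>, loosened by what a single move of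
  Bob can do; the third conjunct says that the opening is not over yet.\<close>

definition opening_alice ::
  "('a \<Rightarrow> nat option) \<Rightarrow> 'a set \<Rightarrow> 'a set \<Rightarrow> 'a set \<Rightarrow> bool" where
  "opening_alice f S X Y \<longleftrightarrow> S = {v \<in> X \<union> Y. f v = None} \<and>
     card (colours f X) + card (colours f Y) \<le> 4 \<and>
     (card (colours f X) \<le> 1 \<or> card (colours f Y) \<le> 1) \<and>
     card (colours f X) \<le> card (colours f Y) + 2 \<and>
     card (colours f Y) \<le> card (colours f X) + 2 \<and>
     card (X \<union> Y - S) \<le> 6 \<and>
     card (X \<union> Y - S) \<le> 2 * (card (colours f X) + card (colours f Y))"

definition bob_inv :: "('a \<Rightarrow> nat option) \<Rightarrow> 'a set \<Rightarrow> 'a set \<Rightarrow> 'a set \<Rightarrow> bool" where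
  "bob_inv f S X Y \<longleftrightarrow> safe f S X \<and> safe f S Y \<or> opening_bob f S X Y"

text \<open>Bob can spoil safety only on the side he touches, and that side is then securable at
  once.\<close>

definition alice_inv :: "('a \<Rightarrow> nat option) \<Rightarrow> 'a set \<Rightarrow> 'a set \<Rightarrow> 'a set \<Rightarrow> bool" where
  "alice_inv f S X Y \<longleftrightarrow> safe f S X \<and> safe f S Y \<or> securable f S X Y \<and> safe f S Y \<or>
     securable f S Y X \<and> safe f S X \<or> opening_alice f S X Y"

lemma opening_commute:
  "opening_bob f S X Y \<longleftrightarrow> opening_bob f S Y X"
  "opening_alice f S X Y \<longleftrightarrow> opening_alice f S Y X"
  unfolding opening_bob_def opening_alice_def Un_commute[of X Y]
    add.commute[of "card (colours f X)" "card (colours f Y)"] by blast+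

lemma bob_inv_commute: "bob_inv f S X Y \<longleftrightarrow> bob_inv f S Y X"
  unfolding bob_inv_def opening_commute(1)[of f S X Y] by blast

lemma alice_inv_commute: "alice_inv f S X Y \<longleftrightarrow> alice_inv f S Y X"
  unfolding alice_inv_def opening_commute(2)[of f S X Y] by blast

lemma opening_played_colours:
  assumes "S = {v \<in> X \<union> Y. f v = None}"
  shows "colours f (X - S) = colours f X" "colours f (Y - S) = colours f Y"
  using assms by (force simp: colours_def)+

section \<open>Two sides of at least five vertices: colour bounds\<close>

locale sides =
  fixes X Y :: "'a set"
  assumes finX: "finite X" and finY: "finite Y" and disj: "X \<inter> Y = {}"
    and cardX: "5 \<le> card X" and cardY: "5 \<le> card Y"
begin

lemma swap: "sides Y X"
  using finX finY disj cardX cardY by unfold_locales auto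

definition proper :: "('a \<Rightarrow> nat option) \<Rightarrow> 'a set \<Rightarrow> bool" where
  "proper f S \<longleftrightarrow> colours f X \<subseteq> {1..5} \<and> colours f Y \<subseteq> {1..5} \<and>
     colours f X \<inter> colours f Y = {} \<and> S \<subseteq> X \<union> Y \<and> (\<forall>v\<in>X \<union> Y - S. f v \<noteq> None)"

text \<open>No colour occurs on both sides, so the two palettes are disjoint subsets of
  \<open>{1..5}\<close>.\<close>

lemma card_le_5:
  assumes "proper f S"
  shows "card (colours f X) + card (colours f Y) \<le> 5"
proof -
  have "card (colours f X) + card (colours f Y) = card (colours f X \<union> colours f Y)"
    using assms finX finY by (subst card_Un_disjoint) (auto simp: finite_colours proper_def)
  also have "\<dots> \<le> card {1..5::nat}"
    using assms by (intro card_mono) (auto simp: proper_def)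
  finally show ?thesis by simp
qed

lemma ex_free_colour:
  assumes "finite C" "card C \<le> 4"
  shows "\<exists>c::nat. c \<in> {1..5} \<and> c \<notin> C"
proof (rule ccontr)
  assume "\<not> ?thesis"
  then have "card {1..5::nat} \<le> card C" by (intro card_mono assms) auto
  then show False using assms by simp
qed

text \<open>Forbidden are the colour of \<open>v\<close>, if any, and at most three colours of
  \<open>Y\<close>: at most four of the five.\<close>

lemma ex_usable:
  assumes "card (colours f Y) \<le> 3"
  shows "\<exists>c. usable f Y v c"
proof -
  have "card (set_option (f v) \<union> colours f Y) \<le> card (set_option (f v)) + card (colours f Y)"
    by (rule card_Un_le)
  also have "\<dots> \<le> 4" using assms by (cases "f v") auto
  finally show ?thesis
    using ex_free_colour[of "set_option (f v) \<union> colours f Y"] finY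
    by (auto simp: usable_def finite_colours)
qed

lemma proper_move:
  assumes "proper f S" "v \<in> X" "usable f Y v c"
  shows "proper (f(v \<mapsto> c)) (S - {v})"
proof -
  have "v \<notin> Y" using assms disj by auto
  then show ?thesis
    using assms colours_mono[of "X - {v}" X f]
    by (auto simp: proper_def usable_def colours_upd colours_upd_outside)
qed

text \<open>Any recolouring of the unplayed partner produces a colour other than \<open>y\<close>,
  while \<open>y\<close> stays visible on a played vertex.\<close>

lemma prepared_securable:
  assumes "prepared f S X" "None \<notin> f ` X" "card (colours f Y) \<le> 3"
  shows "securable f S X Y"
proof -
  obtain v where v: "v \<in> X \<inter> S" "f v \<in> f ` (X - S)"
    using assms by (auto simp: prepared_def)
  then obtain y where y: "f v = Some y" using assms(2) by (metis IntD1 image_eqI not_None_eq)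
  then have "y \<in> colours f (X - S)" using v by (auto simp: colours_def)
  moreover obtain c where c: "usable f Y v c" using ex_usable assms by blast
  moreover have "c \<noteq> y" using c y by (auto simp: usable_def)
  ultimately have "card {c, y} \<le> card (insert c (colours f (X - S)))"
    using finX by (intro card_mono) (auto simp: finite_colours)
  then have "2 \<le> card (insert c (colours f (X - S)))" using \<open>c \<noteq> y\<close> by simp
  then show ?thesis using v c unfolding securable_def by blast
qed

section \<open>Moves of Bob\<close>

lemma bob_opening:
  assumes "opening_bob f S X Y" "v \<in> X \<inter> S"
  shows "alice_inv (f(v \<mapsto> c)) (S - {v}) X Y"
proof -
  let ?f = "f(v \<mapsto> c)" and ?S = "S - {v}"
  have S: "S = {v \<in> X \<union> Y. f v = None}" using assms by (simp add: opening_bob_def)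
  then have S': "?S = {u \<in> X \<union> Y. ?f u = None}" by auto
  have v: "v \<notin> Y" "f v = None" using assms disj S by auto
  have Y: "colours ?f Y = colours f Y" using v by (simp add: colours_upd_outside)
  have "colours f (X - {v}) = colours f X" using v by (force simp: colours_def)
  then have X: "colours ?f X = insert c (colours f X)" using assms by (simp add: colours_upd)
  then have cX: "card (colours ?f X) = card (colours f X) \<or> card (colours ?f X) = Suc (card (colours f X))"
    using finX by (simp add: card_insert_if finite_colours)
  have "X \<union> Y - ?S = insert v (X \<union> Y - S)" using assms by auto
  then have N: "card (X \<union> Y - ?S) = Suc (card (X \<union> Y - S))"
    using assms finX finY by simp
  show ?thesis
  proof (cases "2 \<le> card (colours ?f X) \<and> 2 \<le> card (colours ?f Y)")
    case True
    \<comment> \<open>In the opening every coloured vertex is a played one, so two colours on each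
      side mean that both are secured.\<close>
    then have "secured ?f ?S X" "secured ?f ?S Y"
      unfolding secured_def opening_played_colours[OF S'] by blast+
    then show ?thesis using finX finY by (auto simp: alice_inv_def intro: secured_imp_safe)
  next
    case False
    then have "opening_alice ?f ?S X Y"
      using assms(1) cX Y N S' unfolding opening_alice_def opening_bob_def by auto
    then show ?thesis by (simp add: alice_inv_def)
  qed
qed

text \<open>A secured side stays secured. On a prepared side Bob either recolours the unplayed
  partner, which secures the side, or leaves the preparation intact. On an untouched side
  \<open>c\<close> becomes the only played colour, and Alice needs a second vertex that can take a
  colour other than \<open>c\<close>.\<close>

lemma bob_safe:
  assumes "proper f S" "safe f S X" "safe f S Y" "v \<in> X \<inter> S" "usable f Y v c"
  shows "alice_inv (f(v \<mapsto> c)) (S - {v}) X Y"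
proof -
  let ?f = "f(v \<mapsto> c)" and ?S = "S - {v}"
  have vY: "v \<notin> Y" using assms disj by auto
  have Y: "safe ?f ?S Y" using assms vY by (intro safe_upd_outside)
  \<comment> \<open>Counted before the move: Bob may leave a single colour on \<open>X\<close>, but
    \<open>Y\<close> is unchanged, so the bound on \<open>Y\<close> persists.\<close>
  have "2 \<le> card (colours f X)" using assms by (simp add: safe_def)
  then have Y3: "card (colours f Y) \<le> 3" using card_le_5[OF assms(1)] by simp
  have cY: "colours ?f Y = colours f Y" using vY by (simp add: colours_upd_outside)
  have PX: "colours ?f (X - ?S) = insert c (colours f (X - S))"
    using played_colours_upd[OF assms(4)] .
  have "safe ?f ?S X \<or> securable ?f ?S X Y"
  proof (cases "secured f S X")
    case True
    then show ?thesis using secured_move[OF finX assms(4)] by blast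
  next
    case False
    then have full: "None \<notin> f ` X" and cases: "X \<subseteq> S \<or> prepared f S X"
      using assms by (auto simp: safe_def good_def)
    from cases show ?thesis
    proof
      assume "prepared f S X"
      then obtain w where w: "w \<in> X \<inter> S" "f w \<in> f ` (X - S)" by (auto simp: prepared_def)
      show ?thesis
      proof (cases "w = v")
        case True
        obtain y where y: "f v = Some y" using full w True by (metis IntD1 image_eqI not_None_eq)
        then have "y \<in> colours f (X - S)" using w True by (auto simp: colours_def)
        moreover have "c \<noteq> y" using assms(5) y by (auto simp: usable_def)
        ultimately have "card {c, y} \<le> card (insert c (colours f (X - S)))"
          using finX by (intro card_mono) (auto simp: finite_colours)
        then show ?thesis using securable_move[OF finX assms(4)] \<open>c \<noteq> y\<close> by auto
      next
        case False
        have "prepared ?f ?S X"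
          unfolding prepared_def
        proof (rule bexI[of _ w])
          obtain u where "u \<in> X - S" "f u = f w" using w by auto
          then show "?f w \<in> ?f ` (X - ?S)" using False assms(4) by (auto intro!: image_eqI[of _ _ u])
          show "w \<in> X \<inter> ?S" using w False by auto
        qed
        moreover have "None \<notin> ?f ` X" using full by auto
        ultimately show ?thesis using prepared_securable Y3 cY by simp
      qed
    next
      assume XS: "X \<subseteq> S"
      have "X - {v} \<noteq> {}" using cardX card_mono[of "{v}" X] by auto
      have "\<exists>w\<in>X - {v}. \<exists>c'. usable f Y w c' \<and> c' \<noteq> c"
      proof (cases "\<exists>w\<in>X - {v}. f w = Some c")
        case True
        \<comment> \<open>\<open>w\<close> already has Bob's colour, so every recolouring of it
          differs from \<open>c\<close>.\<close>
        then obtain w where w: "w \<in> X - {v}" "f w = Some c" by blast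
        obtain c' where "usable f Y w c'" using ex_usable Y3 by blast
        moreover from this have "c' \<noteq> c" using w by (auto simp: usable_def)
        ultimately show ?thesis using w by blast
      next
        case False
        obtain w where w: "w \<in> X - {v}" using \<open>X - {v} \<noteq> {}\<close> by blast
        then obtain x where x: "f w = Some x" using full by (metis DiffD1 image_eqI not_None_eq)
        \<comment> \<open>Here \<open>c\<close> is new on \<open>X\<close>. An old colour of
          \<open>X\<close> other than that of \<open>w\<close> therefore differs from
          \<open>c\<close>, and it is usable because it does not occur on \<open>Y\<close>.\<close>
        have "c \<notin> colours f X" using False assms(5) by (force simp: colours_def usable_def)
        have "\<not> colours f X \<subseteq> {x}"
          using \<open>2 \<le> card (colours f X)\<close> card_mono[of "{x}" "colours f X"] by auto
        then obtain c' where "c' \<in> colours f X" "c' \<noteq> x" by auto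
        moreover have "c' \<in> {1..5}" "c' \<notin> colours f Y"
          using assms(1) \<open>c' \<in> colours f X\<close> by (auto simp: proper_def)
        ultimately show ?thesis using w x \<open>c \<notin> colours f X\<close>
          by (intro bexI[of _ w] exI[of _ c']) (auto simp: usable_def)
      qed
      then obtain w c' where w: "w \<in> X - {v}" "usable f Y w c'" "c' \<noteq> c" by blast
      have "card {c', c} \<le> card (insert c' (colours ?f (X - ?S)))"
        using PX finX by (intro card_mono) (auto simp: finite_colours)
      then have "2 \<le> card (insert c' (colours ?f (X - ?S)))" using w by simp
      moreover have "usable ?f Y w c'" "w \<in> X \<inter> ?S" using w XS cY by (auto simp: usable_def)
      ultimately have "securable ?f ?S X Y" unfolding securable_def by blast
      then show ?thesis ..
    qed
  qed
  then show ?thesis using Y by (auto simp: alice_inv_def)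
qed

lemma bob_step_X:
  assumes "proper f S" "bob_inv f S X Y" "v \<in> X \<inter> S" "usable f Y v c"
  shows "alice_inv (f(v \<mapsto> c)) (S - {v}) X Y"
  using assms bob_opening bob_safe unfolding bob_inv_def by blast

text \<open>If both sides are safe, two colours on \<open>X\<close> leave at most three for
  \<open>Y\<close>; in the opening there are at most three in all.\<close>

lemma ex_usable_bob:
  assumes "proper f S" "bob_inv f S X Y"
  shows "\<exists>c. usable f Y v c"
proof (rule ex_usable)
  show "card (colours f Y) \<le> 3"
    using assms card_le_5[OF assms(1)] by (auto simp: bob_inv_def safe_def opening_bob_def)
qed

section \<open>Replies of Alice\<close>

text \<open>At most four colours are in use, so Alice can add one new to both sides. This either
  gives both sides two colours or restores the balance required at Bob's turn.\<close>

lemma alice_opening_X: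
  assumes "proper f S" "opening_alice f S X Y" "card (colours f X) \<le> card (colours f Y)"
  shows "\<exists>v\<in>X \<inter> S. \<exists>c. usable f Y v c \<and> bob_inv (f(v \<mapsto> c)) (S - {v}) X Y"
proof -
  have S: "S = {v \<in> X \<union> Y. f v = None}" using assms by (simp add: opening_alice_def)
  have "card (X - S) + card (Y - S) = card (X \<union> Y - S)"
    using finX finY disj by (subst card_Un_disjoint[symmetric]) (auto intro: arg_cong[of _ _ card])
  moreover have "card (colours f Y) \<le> card (Y - S)"
    using opening_played_colours[OF S] finY by (metis card_colours_le finite_Diff)
  \<comment> \<open>Were five vertices of \<open>X\<close> played, at most one of the at most six
    would lie in \<open>Y\<close>. Each side would then have at most one colour, which allows only
    four played vertices.\<close>
  ultimately have "card (X - S) < 5"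
    using assms(2,3) unfolding opening_alice_def by auto
  then have "X \<inter> S \<noteq> {}" using cardX by (metis Diff_triv not_less)
  then obtain v where v: "v \<in> X \<inter> S" by blast
  have "card (colours f X \<union> colours f Y) \<le> 4"
    using assms(2) card_Un_le[of "colours f X" "colours f Y"] unfolding opening_alice_def by linarith
  then obtain c where c: "c \<in> {1..5}" "c \<notin> colours f X" "c \<notin> colours f Y"
    using ex_free_colour[of "colours f X \<union> colours f Y"] finX finY by (auto simp: finite_colours)
  let ?f = "f(v \<mapsto> c)" and ?S = "S - {v}"
  have v': "v \<notin> Y" "f v = None" using v disj S by auto
  have S': "?S = {u \<in> X \<union> Y. ?f u = None}" using S by auto
  have Y: "colours ?f Y = colours f Y" using v' by (simp add: colours_upd_outside)
  have "colours f (X - {v}) = colours f X" using v' by (force simp: colours_def)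
  then have "colours ?f X = insert c (colours f X)" using v by (simp add: colours_upd)
  then have X: "card (colours ?f X) = Suc (card (colours f X))"
    using c finX by (simp add: finite_colours)
  have "X \<union> Y - ?S = insert v (X \<union> Y - S)" using v by auto
  then have N: "card (X \<union> Y - ?S) = Suc (card (X \<union> Y - S))"
    using v finX finY by simp
  have "bob_inv ?f ?S X Y"
  proof (cases "2 \<le> card (colours ?f X) \<and> 2 \<le> card (colours ?f Y)")
    case True
    then have "secured ?f ?S X" "secured ?f ?S Y"
      unfolding secured_def opening_played_colours[OF S'] by blast+
    then show ?thesis using finX finY by (auto simp: bob_inv_def intro: secured_imp_safe)
  next
    case False
    then have "opening_bob ?f ?S X Y"
      using assms(2,3) X Y N S' unfolding opening_alice_def opening_bob_def by auto
    then show ?thesis by (simp add: bob_inv_def)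
  qed
  moreover have "usable f Y v c" using c v' by (auto simp: usable_def)
  ultimately show ?thesis using v by blast
qed

lemma alice_secures:
  assumes "securable f S X Y" "safe f S Y"
  shows "\<exists>v\<in>X \<inter> S. \<exists>c. usable f Y v c \<and> bob_inv (f(v \<mapsto> c)) (S - {v}) X Y"
proof -
  obtain v c where v: "v \<in> X \<inter> S" "usable f Y v c" "2 \<le> card (insert c (colours f (X - S)))"
    using assms by (auto simp: securable_def)
  moreover have "v \<notin> Y" using v disj by auto
  ultimately show ?thesis
    using assms securable_move[OF finX] safe_upd_outside[of f S Y v c] unfolding bob_inv_def by blast
qed

text \<open>
  Repainting a vertex of a non-singleton class in a colour already used on its side keeps two colours
  on the side and makes it prepared. If Bob then destroys the preparation, he secures the side.
\<close>

lemma alice_prepares: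
  assumes "proper f S" "safe f S X" "safe f S Y" "X \<subseteq> S" "None \<notin> f ` X"
  shows "\<exists>v\<in>X \<inter> S. \<exists>c. usable f Y v c \<and> bob_inv (f(v \<mapsto> c)) (S - {v}) X Y"
proof -
  have "2 \<le> card (colours f X)" using assms by (simp add: safe_def)
  have X3: "card (colours f X) \<le> 3"
    using assms card_le_5[OF assms(1)] by (simp add: safe_def)
  have "f ` X \<subseteq> Some ` colours f X"
  proof
    fix y assume "y \<in> f ` X"
    moreover from this obtain c where "y = Some c" using assms(5) by (metis not_None_eq)
    ultimately show "y \<in> Some ` colours f X" by (auto simp: colours_def)
  qed
  then have "f ` X = Some ` colours f X" using Some_image_colours by blast
  then have "card (f ` X) < card X" using X3 cardX by (simp add: card_image)
  \<comment> \<open>Safety of \<open>Y\<close> leaves at most three colours for the five or more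
    vertices of \<open>X\<close>.\<close>
  then have "\<not> inj_on f X" by (rule pigeonhole)
  then obtain v v' where v: "v \<in> X" "v' \<in> X" "v \<noteq> v'" "f v = f v'" by (auto simp: inj_on_def)
  then obtain x where x: "f v = Some x" using assms(5) by (metis image_eqI not_None_eq)
  have "\<not> colours f X \<subseteq> {x}"
    using \<open>2 \<le> card (colours f X)\<close> card_mono[of "{x}" "colours f X"] by auto
  then obtain c where c: "c \<in> colours f X" "c \<noteq> x" by auto
  then obtain w where w: "w \<in> X" "f w = Some c" by (auto simp: colours_def)
  let ?f = "f(v \<mapsto> c)" and ?S = "S - {v}"
  have "usable f Y v c" using assms(1) c x by (auto simp: usable_def proper_def)
  moreover have "safe ?f ?S Y" using assms disj v by (intro safe_upd_outside) auto
  moreover have "prepared ?f ?S X"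
    unfolding prepared_def using w v x c assms(4) by (intro bexI[of _ w]) (auto intro!: image_eqI[of _ _ v])
  moreover have "None \<notin> ?f ` X" using assms(5) by auto
  moreover have "colours ?f X = colours f X"
  proof -
    \<comment> \<open>\<open>v'\<close> still shows the old colour of \<open>v\<close>.\<close>
    have "f ` (X - {v}) = f ` X" using v by (auto simp: image_iff)
    then have "colours f (X - {v}) = colours f X" by (simp add: colours_def)
    then show ?thesis using v c by (auto simp: colours_upd)
  qed
  ultimately show ?thesis
    using v assms(2,4) by (auto simp: bob_inv_def safe_def good_def intro!: bexI[of _ v] exI[of _ c])
qed

text \<open>Alice prepares an untouched side. A touched side that is good but not secured is
  prepared already, and she secures it.\<close>

lemma alice_unsecured_X:
  assumes "proper f S" "safe f S X" "safe f S Y" "\<not> secured f S X"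
  shows "\<exists>v\<in>X \<inter> S. \<exists>c. usable f Y v c \<and> bob_inv (f(v \<mapsto> c)) (S - {v}) X Y"
proof (cases "X \<subseteq> S")
  case True
  then show ?thesis using assms alice_prepares by (auto simp: safe_def good_def secured_def)
next
  case False
  moreover have "card (colours f Y) \<le> 3"
    using assms card_le_5[OF assms(1)] by (simp add: safe_def)
  ultimately have "securable f S X Y"
    using assms prepared_securable by (auto simp: safe_def good_def)
  then show ?thesis using assms alice_secures by blast
qed

text \<open>On a secured side every legal move is harmless, so this serves as a waiting
  move.\<close>

lemma alice_secured_X:
  assumes "proper f S" "safe f S X" "safe f S Y" "secured f S X" "v \<in> X \<inter> S"
  shows "\<exists>v\<in>X \<inter> S. \<exists>c. usable f Y v c \<and> bob_inv (f(v \<mapsto> c)) (S - {v}) X Y"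
proof -
  have "card (colours f Y) \<le> 3"
    using assms card_le_5[OF assms(1)] by (simp add: safe_def)
  then obtain c where "usable f Y v c" using ex_usable by blast
  moreover have "v \<notin> Y" using assms disj by auto
  ultimately show ?thesis
    using assms secured_move[OF finX] safe_upd_outside[of f S Y v c] unfolding bob_inv_def by blast
qed

section \<open>Symmetry of the sides and single steps\<close>

interpretation swapped: sides Y X by (rule swap)

lemma proper_commute: "swapped.proper f S \<longleftrightarrow> proper f S"
  unfolding proper_def swapped.proper_def by blast

definition legal :: "('a \<Rightarrow> nat option) \<Rightarrow> 'a \<Rightarrow> nat \<Rightarrow> bool" where
  "legal f v c \<longleftrightarrow> usable f (if v \<in> X then Y else X) v c"

lemma ex_legal_bob:
  assumes "proper f S" "bob_inv f S X Y"
  shows "\<exists>c. legal f v c"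
  using assms ex_usable_bob swapped.ex_usable_bob[of f S]
  by (simp add: legal_def proper_commute bob_inv_commute[of _ _ Y])

lemma proper_step:
  assumes "proper f S" "v \<in> S" "legal f v c"
  shows "proper (f(v \<mapsto> c)) (S - {v})"
proof (cases "v \<in> X")
  case True
  then show ?thesis using assms proper_move by (simp add: legal_def)
next
  case False
  then have "v \<in> Y" using assms by (auto simp: proper_def)
  then show ?thesis
    using assms False swapped.proper_move by (simp add: legal_def proper_commute)
qed

lemma bob_step:
  assumes "proper f S" "bob_inv f S X Y" "v \<in> S" "legal f v c"
  shows "alice_inv (f(v \<mapsto> c)) (S - {v}) X Y"
proof (cases "v \<in> X")
  case True
  then show ?thesis using assms bob_step_X by (simp add: legal_def)
next
  case False
  then have "v \<in> Y" using assms by (auto simp: proper_def)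
  then show ?thesis
    using assms False swapped.bob_step_X[of f S v c]
    by (simp add: legal_def proper_commute bob_inv_commute[of _ _ Y] alice_inv_commute[of _ _ Y])
qed

lemma alice_step:
  assumes "proper f S" "alice_inv f S X Y" "S \<noteq> {}"
  shows "\<exists>v\<in>S. \<exists>c. legal f v c \<and> bob_inv (f(v \<mapsto> c)) (S - {v}) X Y"
proof -
  have "(\<exists>v\<in>X \<inter> S. \<exists>c. usable f Y v c \<and> bob_inv (f(v \<mapsto> c)) (S - {v}) X Y) \<or>
    (\<exists>v\<in>Y \<inter> S. \<exists>c. usable f X v c \<and> bob_inv (f(v \<mapsto> c)) (S - {v}) Y X)"
    (is "?X \<or> ?Y")
  proof -
    have p: "swapped.proper f S" using assms proper_commute by simp
    consider "safe f S X" "safe f S Y" | "securable f S X Y" "safe f S Y"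
      | "securable f S Y X" "safe f S X" | "opening_alice f S X Y"
      using assms unfolding alice_inv_def by blast
    then show ?thesis
    proof cases
      case 1
      \<comment> \<open>With both sides safe, Alice may play on the side of any available
        vertex.\<close>
      obtain v where "v \<in> S" using assms(3) by blast
      then consider "v \<in> X \<inter> S" | "v \<in> Y \<inter> S" using assms(1) by (auto simp: proper_def)
      then show ?thesis
      proof cases
        case a: 1
        then show ?thesis
          using alice_unsecured_X[OF assms(1) 1] alice_secured_X[OF assms(1) 1 _ a] by blast
      next
        case a: 2
        then show ?thesis
          using swapped.alice_unsecured_X[OF p 1(2,1)] swapped.alice_secured_X[OF p 1(2,1) _ a]
          by blast
      qed
    next
      case 2
      then show ?thesis using alice_secures by blast
    next
      case 3
      then show ?thesis using swapped.alice_secures by blast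
    next
      case 4
      then have "opening_alice f S Y X" by (simp add: opening_commute)
      then show ?thesis
        using 4 p assms(1) alice_opening_X swapped.alice_opening_X
        by (meson nle_le)
    qed
  qed
  then show ?thesis
  proof
    assume ?X
    then show ?thesis by (fastforce simp: legal_def)
  next
    assume ?Y
    then obtain v c where "v \<in> Y \<inter> S" "usable f X v c" "bob_inv (f(v \<mapsto> c)) (S - {v}) Y X"
      by blast
    then show ?thesis
      using disj by (intro bexI[of _ v] exI[of _ c]) (auto simp: legal_def bob_inv_commute[of _ _ Y])
  qed
qed

section \<open>Passage to a new round\<close>

text \<open>When a round ends, all vertices are coloured and both sides become untouched, so only
  the two colours per side have to survive.\<close>

lemma new_round_safe:
  assumes "proper f {}" "safe f {} X" "safe f {} Y"
  shows "safe f (X \<union> Y) X \<and> safe f (X \<union> Y) Y"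
proof -
  have "f v \<noteq> None" if "v \<in> X \<union> Y" for v using that assms(1) by (auto simp: proper_def)
  then have "None \<notin> f ` X" "None \<notin> f ` Y" by (metis Un_iff imageE)+
  then show ?thesis using assms by (simp add: safe_def good_def)
qed

lemma card_Un_ge: "10 \<le> card (X \<union> Y)"
  using cardX cardY finX finY disj by (simp add: card_Un_disjoint)

text \<open>The opening allows at most six played vertices, fewer than the ten or more present, and
  a securable side has an available vertex; so at the end of a round both sides are safe. The sides
  may differ in size, so either player may make the last move of a round.\<close>

lemma new_round:
  assumes "proper f {}"
  shows "proper f (X \<union> Y)"
    and "bob_inv f {} X Y \<Longrightarrow> bob_inv f (X \<union> Y) X Y"
    and "alice_inv f {} X Y \<Longrightarrow> alice_inv f (X \<union> Y) X Y"
proof -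
  have "\<not> opening_bob f {} X Y" "\<not> opening_alice f {} X Y" "\<not> securable f {} X Y" "\<not> securable f {} Y X"
    using card_Un_ge by (simp_all add: opening_bob_def opening_alice_def securable_def)
  then show "bob_inv f {} X Y \<Longrightarrow> bob_inv f (X \<union> Y) X Y"
    and "alice_inv f {} X Y \<Longrightarrow> alice_inv f (X \<union> Y) X Y"
    using new_round_safe[OF assms] by (simp_all add: bob_inv_def alice_inv_def)
  show "proper f (X \<union> Y)" using assms by (auto simp: proper_def)
qed

lemma start: "proper (\<lambda>v. None) (X \<union> Y)" "alice_inv (\<lambda>v. None) (X \<union> Y) X Y"
proof -
  have "colours (\<lambda>v. None) A = {}" for A :: "'a set" by (auto simp: colours_def)
  then show "proper (\<lambda>v. None) (X \<union> Y)" "alice_inv (\<lambda>v. None) (X \<union> Y) X Y"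
    by (simp_all add: proper_def alice_inv_def opening_alice_def Un_def)
qed

section \<open>The game on a complete bipartite graph\<close>

theorem ex_winning_strategy:
  fixes G :: "('a, 'b) pre_digraph"
  assumes verts: "verts G = X \<union> Y" and arcs: "arcs_ends G = X \<times> Y \<union> Y \<times> X"
  shows "\<exists>\<sigma>. winning_strategy G 5 \<sigma>"
proof -
  let ?S = "\<lambda>h. Collect (available G h)"
  define base where "base h \<longleftrightarrow> balanced G h \<and> proper (current_colour h) (?S h)" for h
  have S: "?S h \<subseteq> X \<union> Y" for h using verts by (auto simp: available_def)
  \<comment> \<open>The neighbours of a vertex are exactly the opposite side.\<close>
  have legal: "legal_colour G 5 h v c \<longleftrightarrow> legal (current_colour h) v c" if "available G h v" for h v c
  proof -
    have "v \<in> X \<union> Y" using that S by auto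
    then have "v \<rightarrow>\<^bsub>G\<^esub> u \<longleftrightarrow> u \<in> (if v \<in> X then Y else X)" for u
      using arcs disj by auto
    then show ?thesis
      unfolding legal_colour_def legal_def usable_def colours_def by (auto simp: image_iff)
  qed
  \<comment> \<open>The single-step lemmas speak of \<open>?S h - {v}\<close>; this carries their
    results over to the actual available set, which differs when the round ends.\<close>
  have step: "base (h @ [(v, c)]) \<and>
      (bob_inv ((current_colour h)(v \<mapsto> c)) (?S h - {v}) X Y \<longrightarrow>
        bob_inv (current_colour (h @ [(v, c)])) (?S (h @ [(v, c)])) X Y) \<and>
      (alice_inv ((current_colour h)(v \<mapsto> c)) (?S h - {v}) X Y \<longrightarrow>
        alice_inv (current_colour (h @ [(v, c)])) (?S (h @ [(v, c)])) X Y)"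
    if h: "base h" "legal_move G 5 h (v, c)" for h v c
  proof -
    have v: "available G h v" "legal (current_colour h) v c"
      using h legal by (auto simp: legal_move_def)
    define T where "T = ?S h - {v}"
    have "proper ((current_colour h)(v \<mapsto> c)) T" (is "proper ?f T")
      unfolding T_def using h v by (intro proper_step) (auto simp: base_def)
    moreover have "balanced G (h @ [(v, c)])" using h v by (simp add: base_def balanced_snoc)
    moreover have "?S (h @ [(v, c)]) = (if T = {} then X \<union> Y else T)"
      using available_snoc[of G h v c] h v verts unfolding T_def by (simp add: base_def)
    ultimately show ?thesis
      using new_round[of ?f] unfolding base_def current_colour_snoc T_def[symmetric]
      by (cases "T = {}") simp_all
  qed
  let ?M = "\<lambda>h. base h \<and> alice_inv (current_colour h) (?S h) X Y"
  let ?J = "\<lambda>h. base h \<and> bob_inv (current_colour h) (?S h) X Y"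
  have S_ne: "?S h \<noteq> {}" for h
  proof -
    have "X \<union> Y \<noteq> {}" using card_Un_ge by auto
    \<comment> \<open>A vertex chosen least often is available.\<close>
    then obtain v where "is_arg_min (times_chosen h) (\<lambda>v. v \<in> X \<union> Y) v"
      using finX finY ex_is_arg_min_if_finite[of "X \<union> Y" "times_chosen h"] by auto
    then have "available G h v" by (auto simp: is_arg_min_linorder available_def verts)
    then show ?thesis by blast
  qed
  show ?thesis
  proof (rule winning_strategyI[of ?M G 5 ?J])
    have "?S [] = X \<union> Y" by (auto simp: available_def times_chosen_def verts)
    moreover have "current_colour [] = (\<lambda>v::'a. None)" by (simp add: current_colour_def)
    ultimately show "?M []" using start
      by (simp add: base_def balanced_def times_chosen_def)
  next
    fix h assume h: "?M h"
    then obtain v c where vc: "available G h v" "legal (current_colour h) v c"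
      "bob_inv ((current_colour h)(v \<mapsto> c)) (?S h - {v}) X Y"
      using alice_step[OF _ _ S_ne] unfolding base_def by blast
    then have "legal_move G 5 h (v, c)" using legal by (simp add: legal_move_def)
    then show "\<exists>m. legal_move G 5 h m \<and> ?J (h @ [m])" using step h vc by blast
  next
    fix h v assume "?J h" "available G h v"
    then show "\<exists>c. legal_colour G 5 h v c" using ex_legal_bob legal by (auto simp: base_def)
  next
    fix h m assume h: "?J h" "legal_move G 5 h m"
    obtain v c where m: "m = (v, c)" by (cases m)
    have v: "v \<in> ?S h" "legal (current_colour h) v c"
      using h legal m by (auto simp: legal_move_def)
    then have "alice_inv ((current_colour h)(v \<mapsto> c)) (?S h - {v}) X Y"
      using h by (intro bob_step) (auto simp: base_def)
    then show "?M (h @ [m])" using step h m by blast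
  qed
qed

end

theorem proposition3p5:
  fixes G :: "('a, 'b) pre_digraph" and n :: nat
  assumes "n \<ge> 5" and "complete_bipartite_digraph n n G"
  shows "eternal_game_chromatic_number G \<le> 5"
proof -
  obtain U V where UV: "verts G = U \<union> V" "U \<inter> V = {}" "card U = n" "card V = n"
    "arcs_ends G = U \<times> V \<union> V \<times> U"
    using assms(2) unfolding complete_bipartite_digraph_def by blast
  then interpret sides U V
    \<comment> \<open>Infinite sets have \<open>card\<close> zero, so \<open>n \<ge> 5\<close>
      forces both parts to be finite.\<close>
    using assms(1) by unfold_locales (auto intro: card_ge_0_finite)
  have "5 \<in> {k. \<exists>\<sigma>. winning_strategy G k \<sigma>}" using ex_winning_strategy UV by blast
  then have "eternal_game_chromatic_number G \<le> enat 5"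
    unfolding eternal_game_chromatic_number_def by (rule INF_lower)
  then show ?thesis by (simp add: numeral_eq_enat)
qed

end
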